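(* Let $u,v\in\mathcal{S}_n$ and $s=u^{-1}$, $t=v^{-1}$. Then $u\sim_{ss}v$ if and only if $\Delta_i(s)=\Delta_i(t)$ for each $i\in[2,n-1]$.
   Context: $[m,n]=\{m,m+1,\ldots,n\}$. $\mathbb{P}$ is the set of positive integers and $\mathbb{P}^*$ the set of finite words over $\mathbb{P}$. For $w=w_1\cdots w_n\in\mathbb{P}^*$, $|w|=n$ is its length and $\|w\|=w_1+\cdots+w_n$ its height. For words $u,w$, an index $j\ge 1$ is an embedding index of $u$ into $w$ if $j+|u|-1\le|w|$ and $u_i\le w_{j+i-1}$ for all $1\le i\le|u|$; $Em(u,w)$ denotes the set of all embedding indices of $u$ into $w$. A bijection $f:\mathbb{P}^*\to\mathbb{P}^*$ is weight-preserving if $|f(w)|=|w|$ and $\|f(w)\|=\|w\|$ for all $w$. Two words $u,v$ are super-strongly Wilf equivalent, written $u\sim_{ss}v$, if there is a weight-preserving bijection $f:\mathbb{P}^*\to\mathbb{P}^*$ with $Em(u,w)=Em(v,f(w))$ for all $w\in\mathbb{P}^*$. $\mathcal{S}_n$ is the set of permutations of $\{1,\ldots,n\}$, viewed as words of length $n$ in which each letter occurs exactly once; for $u\in\mathcal{S}_n$, the inverse $s=u^{-1}=s_1s_2\cdots s_n$ has $s_i$ equal to the position of the letter $i$ in $u$. For $s=s_1\cdots s_n\in\mathcal{S}_n$ and $1\le i\le n-1$, let $\Sigma_i(s)=\{s_i,s_{i+1},\ldots,s_n\}$, written in increasing order as $\{s_i^{(i)}<s_{i+1}^{(i)}<\cdots<s_n^{(i)}\}$.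 The vector of consecutive differences is $\Delta_i(s)=(s_{i+1}^{(i)}-s_i^{(i)},\ldots,s_n^{(i)}-s_{n-1}^{(i)})$. *)

theory Defs
  imports Main "HOL-Combinatorics.Multiset_Permutations"
begin

(* Words are lists of naturals with positive letters.  All positions are counted from 1,
   so the letter w_k of the word w is w ! (k - 1). *)

definition words :: "nat list set" where
  "words = {w. \<forall>x \<in> set w. 0 < x}"

abbreviation height :: "nat list \<Rightarrow> nat" where
  "height w \<equiv> sum_list w"

(* The subtractions never truncate, since i and j are at least 1;
   w ! (j + i - 2) is the letter at position j + i - 1. *)
definition Em :: "nat list \<Rightarrow> nat list \<Rightarrow> nat set" where
  "Em u w = {j. 1 \<le> j \<and> j + length u - 1 \<le> length w \<and>
                (\<forall>i \<in> {1..length u}. u ! (i - 1) \<le> w ! (j + i - 2))}"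

definition weight_preserving :: "(nat list \<Rightarrow> nat list) \<Rightarrow> bool" where
  "weight_preserving f \<longleftrightarrow>
     (\<forall>w \<in> words. length (f w) = length w \<and> height (f w) = height w)"

definition super_strongly_Wilf :: "nat list \<Rightarrow> nat list \<Rightarrow> bool" (infix "\<sim>ss" 50) where
  "u \<sim>ss v \<longleftrightarrow>
     (\<exists>f. bij_betw f words words \<and> weight_preserving f \<and> (\<forall>w \<in> words. Em u w = Em v (f w)))"

definition position :: "nat list \<Rightarrow> nat \<Rightarrow> nat" where
  "position u i = (THE p. p \<in> {1..length u} \<and> u ! (p - 1) = i)"

definition perm_inverse :: "nat list \<Rightarrow> nat list" where
  "perm_inverse u = map (position u) [1..<Suc (length u)]"

definition Sigma_set :: "nat \<Rightarrow> nat list \<Rightarrow> nat set" where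
  "Sigma_set i s = {s ! (k - 1) | k. k \<in> {i..length s}}"

(* Each difference is taken between neighbours of a strictly increasing list,
   so subtraction on nat is exact. *)
definition Delta :: "nat \<Rightarrow> nat list \<Rightarrow> nat list" where
  "Delta i s = (let xs = sorted_list_of_set (Sigma_set i s)
                in map (\<lambda>k. xs ! Suc k - xs ! k) [0..<length xs - 1])"

end

theory Submission
  imports Defs "HOL-Library.Set_Algebras"
begin

text \<open>
  Fix a set \<open>E\<close> of positions. Among the words of length \<open>m\<close> into which \<open>u\<close> embeds at every
  position of \<open>E\<close> there is a pointwise least one, the overlay of the copies of \<open>u\<close> placed
  at \<open>E\<close>, and these words are exactly the ones above it. Hence \<open>u \<sim>ss v\<close> means that the overlays
  of \<open>u\<close> and \<open>v\<close> at \<open>E\<close> have the same height for all \<open>E\<close> and \<open>m\<close>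
  (\<open>super_strongly_Wilf_iff_overlay\<close>). In one direction a bijection sends the overlay of \<open>u\<close> to a
  word above the overlay of \<open>v\<close>, and its inverse does the converse. In the other direction,
  the number of words of given weight above a word depends only on the height of that word, so
  \<open>u\<close> and \<open>v\<close> have the same number of words \<open>w\<close> of each weight with \<open>E \<subseteq> Em \<dots> w\<close>;
  inclusion-exclusion turns this into the same number with \<open>Em \<dots> w = E\<close>, and a bijection is
  assembled fibre by fibre.

  A letter is the number of thresholds \<open>i\<close> that it reaches, and the overlay reaches \<open>i \<ge> 2\<close> exactly
  on the sumset \<open>E + level u i\<close>, where \<open>level u i\<close> is the set of places at which \<open>u\<close> does.
  So \<open>u \<sim>ss v\<close> says that
  \<open>\<Sum>i=2..n. card (E + level u i) = \<Sum>i=2..n. card (E + level v i)\<close> for all \<open>E\<close>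
  (\<open>super_strongly_Wilf_iff_sumsets\<close>). For a permutation, \<open>level u i\<close> is \<open>Sigma_set i s\<close> moved down
  by one, and equality of difference vectors says that \<open>level u i\<close> and \<open>level v i\<close> are translates of
  each other. Translates have sumsets with \<open>E\<close> of equal size, which settles sufficiency.

  For necessity (\<open>translates_of_sum_card_sumset_eq\<close>), remove a set \<open>D\<close> from the middle
  of a long interval \<open>E\<close>. The points that \<open>E + A\<close> loses are the \<open>x\<close> with \<open>x - A \<subseteq> D\<close>, so the sums
  count translates of the reflected level sets inside \<open>D\<close>. The level sets of a permutation have
  distinct sizes. Take \<open>D\<close> to be a reflection of \<open>level u k\<close>: larger sets do not fit into
  it, smaller ones contribute the same on both sides by induction, and so the \<open>v\<close> side, too,
  must have a translate of its reflected level set of size \<open>card D\<close> inside \<open>D\<close>, hence equal to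
  \<open>D\<close>. Singletons are always translates, which is why \<open>i = n\<close> is absent from the criterion.
\<close>

section \<open>Counting and fibrewise bijections\<close>

lemma exists_bij_betw_of_card_fibres:
  assumes fin: "\<And>k. finite {x \<in> X. a x = k}" "\<And>k. finite {x \<in> X. b x = k}"
    and card: "\<And>k. card {x \<in> X. a x = k} = card {x \<in> X. b x = k}"
  shows "\<exists>f. bij_betw f X X \<and> (\<forall>x \<in> X. b (f x) = a x)"
proof -
  have "\<forall>k. \<exists>g. bij_betw g {x \<in> X. a x = k} {x \<in> X. b x = k}"
    using fin card by (blast intro: finite_same_card_bij)
  then obtain g where g: "\<And>k. bij_betw (g k) {x \<in> X. a x = k} {x \<in> X. b x = k}"
    by metis
  define f where "f x = g (a x) x" for x
  have f: "f x \<in> X \<and> b (f x) = a x" if "x \<in> X" for x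
    using bij_betwE[OF g[of "a x"]] that by (auto simp: f_def)
  have "inj_on f X"
  proof (rule inj_onI)
    fix x y assume xy: "x \<in> X" "y \<in> X" "f x = f y"
    then have "a x = a y" using f by metis
    with xy show "x = y"
      using bij_betw_imp_inj_on[OF g[of "a x"]] by (auto simp: f_def inj_on_def)
  qed
  moreover have "y \<in> f ` X" if "y \<in> X" for y
  proof -
    have "y \<in> g (b y) ` {x \<in> X. a x = b y}"
      using bij_betw_imp_surj_on[OF g[of "b y"]] that by auto
    then obtain x where "x \<in> X" "a x = b y" "y = g (b y) x" by blast
    then have "y = f x" by (simp add: f_def)
    with \<open>x \<in> X\<close> show ?thesis by blast
  qed
  ultimately have "bij_betw f X X"
    using f by (auto simp: bij_betw_def)
  then show ?thesis using f by blast
qed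

text \<open>
  The number of \<open>x\<close> with \<open>S \<subseteq> \<alpha> x\<close> is the sum, over the sets \<open>T\<close> between \<open>S\<close> and \<open>U\<close>, of the
  number of \<open>x\<close> with \<open>\<alpha> x = T\<close>. This triangular system determines the latter numbers,
  starting from \<open>S = U\<close> and going down.
\<close>
lemma card_fibres_eq_of_card_supersets_eq:
  fixes \<alpha> \<beta> :: "'a \<Rightarrow> 'b set"
  assumes X: "finite X" and U: "finite U"
    and sub: "\<And>x. x \<in> X \<Longrightarrow> \<alpha> x \<subseteq> U" "\<And>x. x \<in> X \<Longrightarrow> \<beta> x \<subseteq> U"
    and eq: "\<And>E. card {x \<in> X. E \<subseteq> \<alpha> x} = card {x \<in> X. E \<subseteq> \<beta> x}"
  shows "card {x \<in> X. \<alpha> x = S} = card {x \<in> X. \<beta> x = S}"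
proof (induction "card (U - S)" arbitrary: S rule: less_induct)
  case less
  define \<T> where "\<T> = {T. S \<subseteq> T \<and> T \<subseteq> U}"
  have fin: "finite \<T>" using U by (auto simp: \<T>_def intro: finite_subset[of _ "Pow U"])
  have split: "card {x \<in> X. S \<subseteq> \<gamma> x} = (\<Sum>T \<in> \<T>. card {x \<in> X. \<gamma> x = T})"
    if "\<And>x. x \<in> X \<Longrightarrow> \<gamma> x \<subseteq> U" for \<gamma> :: "'a \<Rightarrow> 'b set"
  proof -
    have "{x \<in> X. S \<subseteq> \<gamma> x} = (\<Union>T \<in> \<T>. {x \<in> X. \<gamma> x = T})"
      using that by (auto simp: \<T>_def)
    also have "card \<dots> = (\<Sum>T \<in> \<T>. card {x \<in> X. \<gamma> x = T})"
      using fin X by (intro card_UN_disjoint) auto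
    finally show ?thesis .
  qed
  show ?case
  proof (cases "S \<subseteq> U")
    case False
    then have "{x \<in> X. \<alpha> x = S} = {}" "{x \<in> X. \<beta> x = S} = {}" using sub by blast+
    then show ?thesis by (simp only:)
  next
    case True
    then have S: "S \<in> \<T>" by (simp add: \<T>_def)
    have "card {x \<in> X. \<alpha> x = T} = card {x \<in> X. \<beta> x = T}" if "T \<in> \<T> - {S}" for T
    proof (rule less.hyps)
      have "U - T \<subset> U - S" using that by (auto simp: \<T>_def)
      then show "card (U - T) < card (U - S)" using U by (intro psubset_card_mono) auto
    qed
    then have "(\<Sum>T \<in> \<T> - {S}. card {x \<in> X. \<alpha> x = T}) = (\<Sum>T \<in> \<T> - {S}. card {x \<in> X. \<beta> x = T})"
      by (intro sum.cong) auto
    moreover have "(\<Sum>T \<in> \<T>. card {x \<in> X. \<alpha> x = T}) = (\<Sum>T \<in> \<T>. card {x \<in> X. \<beta> x = T})"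
      using split[of \<alpha>] split[of \<beta>] sub eq[of S] by simp
    ultimately show ?thesis
      using sum.remove[OF fin S, of "\<lambda>T. card {x \<in> X. \<alpha> x = T}"]
        sum.remove[OF fin S, of "\<lambda>T. card {x \<in> X. \<beta> x = T}"] by simp
  qed
qed

lemma finite_lists_of_weight: "finite {w. length w = m \<and> height w = h}"
proof (rule finite_subset)
  show "{w. length w = m \<and> height w = h} \<subseteq> {w. set w \<subseteq> {..h} \<and> length w = m}"
    using member_le_sum_list by fastforce
qed (simp add: finite_lists_length_eq)

text \<open>
  Moving the excess of \<open>w\<close> over \<open>x\<close> onto \<open>y\<close> injects the lists above \<open>x\<close> into those above \<open>y\<close>.
\<close>
lemma card_dominating_lists_le:
  fixes x y :: "nat list"
  assumes len: "length x = m" "length y = m" and sum: "sum_list x = sum_list y"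
  shows "card {w. length w = m \<and> sum_list w = h \<and> (\<forall>k<m. x ! k \<le> w ! k)}
    \<le> card {w. length w = m \<and> sum_list w = h \<and> (\<forall>k<m. y ! k \<le> w ! k)}"
    (is "card ?X \<le> card ?Y")
proof (rule card_inj_on_le)
  let ?\<phi> = "\<lambda>w. map (\<lambda>k. w ! k - x ! k + y ! k) [0..<m]"
  show "inj_on ?\<phi> ?X"
  proof (rule inj_onI)
    fix w w' assume w: "w \<in> ?X" "w' \<in> ?X" "?\<phi> w = ?\<phi> w'"
    have "w ! k = w' ! k" if "k < m" for k
    proof -
      have "?\<phi> w ! k = ?\<phi> w' ! k" by (simp only: w(3))
      then have "w ! k - x ! k + y ! k = w' ! k - x ! k + y ! k" using that by simp
      moreover have "x ! k \<le> w ! k" "x ! k \<le> w' ! k" using w that by auto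
      ultimately show ?thesis by linarith
    qed
    then show "w = w'" using w by (auto intro: nth_equalityI)
  qed
  show "?\<phi> ` ?X \<subseteq> ?Y"
  proof (rule image_subsetI)
    fix w assume "w \<in> ?X"
    then have w: "length w = m" "sum_list w = h" "\<forall>k<m. x ! k \<le> w ! k" by auto
    have "(\<Sum>k<m. w ! k - x ! k + y ! k) + (\<Sum>k<m. x ! k) = (\<Sum>k<m. w ! k) + (\<Sum>k<m. y ! k)"
      unfolding sum.distrib[symmetric] using w by (intro sum.cong) auto
    then have "(\<Sum>k<m. w ! k - x ! k + y ! k) = (\<Sum>k<m. w ! k)"
      using sum len by (simp add: sum_list_sum_nth atLeast0LessThan)
    then have "sum_list (?\<phi> w) = h"
      using w by (simp add: sum_list_sum_nth atLeast0LessThan)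
    then show "?\<phi> w \<in> ?Y" by simp
  qed
  show "finite ?Y" by (rule finite_subset[OF _ finite_lists_of_weight[of m h]]) auto
qed

section \<open>Overlays of embedded copies\<close>

text \<open>
  Copies of \<open>u\<close> are placed at the positions in \<open>E\<close>, and the letter at \<open>Suc k\<close> is the
  largest one that any copy puts there. Positions count from 1 and places inside \<open>u\<close> from 0.
  The inserted 1 is the least letter, used where no copy reaches.
\<close>
definition overlay :: "nat list \<Rightarrow> nat set \<Rightarrow> nat \<Rightarrow> nat list" where
  "overlay u E m =
     map (\<lambda>k. Max (insert 1 {u ! d | j d. j \<in> E \<and> d < length u \<and> j + d = Suc k})) [0..<m]"

abbreviation slots :: "nat \<Rightarrow> nat \<Rightarrow> nat set" where
  "slots n m \<equiv> {j. 1 \<le> j \<and> j + n - 1 \<le> m}"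

definition level :: "nat list \<Rightarrow> nat \<Rightarrow> nat set" where
  "level u i = {d. d < length u \<and> i \<le> u ! d}"

lemma finite_level [simp]: "finite (level u i)"
  by (simp add: level_def)

lemma length_overlay [simp]: "length (overlay u E m) = m"
  by (simp add: overlay_def)

lemma finite_overlay_letters:
  "finite {u ! d | j d. j \<in> E \<and> d < length u \<and> j + d = Suc k}"
  by (rule finite_subset[of _ "set u"]) auto

lemma overlay_nth_le_iff:
  assumes "k < m"
  shows "overlay u E m ! k \<le> c \<longleftrightarrow>
    1 \<le> c \<and> (\<forall>j\<in>E. \<forall>d<length u. j + d = Suc k \<longrightarrow> u ! d \<le> c)"
  using assms finite_overlay_letters[of u E k]
  by (simp add: overlay_def) blast

lemma overlay_nth_ge_1: "k < m \<Longrightarrow> 1 \<le> overlay u E m ! k"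
  using overlay_nth_le_iff[of k m u E "overlay u E m ! k"] by simp

lemma overlay_in_words: "overlay u E m \<in> words"
  using overlay_nth_ge_1[of _ m u E]
  by (force simp: words_def in_set_conv_nth)

lemma subset_Em_iff:
  assumes E: "E \<subseteq> slots (length u) m" and w: "w \<in> words" "length w = m"
  shows "E \<subseteq> Em u w \<longleftrightarrow> (\<forall>k<m. overlay u E m ! k \<le> w ! k)"
proof
  assume L: "E \<subseteq> Em u w"
  show "\<forall>k<m. overlay u E m ! k \<le> w ! k"
  proof (intro allI impI)
    fix k assume k: "k < m"
    have "u ! d \<le> w ! k" if "j \<in> E" "d < length u" "j + d = Suc k" for j d
    proof -
      have "Suc d \<in> {1..length u}" using that by simp
      then have "u ! (Suc d - 1) \<le> w ! (j + Suc d - 2)" using L that unfolding Em_def by blast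
      moreover have "j + Suc d - 2 = k" using that by simp
      ultimately show ?thesis by simp
    qed
    moreover have "1 \<le> w ! k" using w k by (auto simp: words_def Suc_le_eq)
    ultimately show "overlay u E m ! k \<le> w ! k" using k by (auto simp: overlay_nth_le_iff)
  qed
next
  assume R: "\<forall>k<m. overlay u E m ! k \<le> w ! k"
  show "E \<subseteq> Em u w"
  proof
    fix j assume j: "j \<in> E"
    have "u ! (i - 1) \<le> w ! (j + i - 2)" if i: "i \<in> {1..length u}" for i
    proof -
      have k: "j + i - 2 < m" "j + (i - 1) = Suc (j + i - 2)" "i - 1 < length u"
        using E j i by auto
      then have "overlay u E m ! (j + i - 2) \<le> w ! (j + i - 2)" using R by blast
      then show ?thesis using k j by (simp add: overlay_nth_le_iff)
    qed
    then show "j \<in> Em u w" using E j w by (auto simp: Em_def)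
  qed
qed

lemma Em_subset_slots: "length w = m \<Longrightarrow> Em u w \<subseteq> slots (length u) m"
  by (auto simp: Em_def)

lemma finite_slots: "finite (slots n m)"
  by (rule finite_subset[of _ "{..Suc m}"]) auto

lemma height_mono_nth:
  fixes x w :: "nat list"
  assumes "length x = length w" "\<forall>k<length w. x ! k \<le> w ! k"
  shows "sum_list x \<le> sum_list w"
  using assms unfolding sum_list_sum_nth by (simp, intro sum_mono) simp

text \<open>
  The image of the overlay of \<open>u\<close> is a word into which \<open>v\<close> embeds at all positions of \<open>E\<close>, so it
  lies above the overlay of \<open>v\<close>.
\<close>
lemma overlay_height_le:
  assumes f: "bij_betw f words words" "weight_preserving f"
    "\<forall>w \<in> words. Em u w = Em v (f w)"
    and len: "length u = length v" and E: "E \<subseteq> slots (length u) m"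
  shows "height (overlay v E m) \<le> height (overlay u E m)"
proof -
  let ?x = "overlay u E m"
  have x: "?x \<in> words" by (rule overlay_in_words)
  have fx: "f ?x \<in> words" using f(1) x by (auto dest: bij_betwE)
  have lfx: "length (f ?x) = m" "height (f ?x) = height ?x"
    using f(2) x by (auto simp: weight_preserving_def)
  have "E \<subseteq> Em u ?x" using subset_Em_iff[OF E x] by simp
  then have "E \<subseteq> Em v (f ?x)" using f(3) x by simp
  then have "\<forall>k<m. overlay v E m ! k \<le> f ?x ! k"
    using subset_Em_iff[of E v m "f ?x"] E len fx lfx by simp
  then show ?thesis using height_mono_nth[of "overlay v E m" "f ?x"] lfx by simp
qed

lemma super_strongly_Wilf_sym:
  assumes "u \<sim>ss v" shows "v \<sim>ss u"
proof -
  obtain f where f: "bij_betw f words words" "weight_preserving f"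
    "\<forall>w \<in> words. Em u w = Em v (f w)"
    using assms unfolding super_strongly_Wilf_def by blast
  let ?g = "inv_into words f"
  have g: "bij_betw ?g words words" using f(1) by (rule bij_betw_inv_into)
  have gw: "?g w \<in> words" "f (?g w) = w" if "w \<in> words" for w
    using that f(1) bij_betwE[OF g] by (auto simp: bij_betw_inv_into_right)
  have "weight_preserving ?g"
    using f(2) gw unfolding weight_preserving_def by metis
  moreover have "\<forall>w \<in> words. Em v w = Em u (?g w)" using f(3) gw by metis
  ultimately show ?thesis using g unfolding super_strongly_Wilf_def by blast
qed

text \<open>
  For the direction from right to left the two words have, within each weight class, equally many
  words whose embedding set contains \<open>E\<close>: those above the overlay if all copies fit
  into length \<open>m\<close>, and none otherwise.
\<close>
lemma super_strongly_Wilf_iff_overlay: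
  assumes len: "length u = length v"
  shows "u \<sim>ss v \<longleftrightarrow>
    (\<forall>m. \<forall>E \<subseteq> slots (length u) m. height (overlay u E m) = height (overlay v E m))"
proof
  assume "u \<sim>ss v"
  then obtain f g where
    f: "bij_betw f words words" "weight_preserving f" "\<forall>w \<in> words. Em u w = Em v (f w)" and
    g: "bij_betw g words words" "weight_preserving g" "\<forall>w \<in> words. Em v w = Em u (g w)"
    using super_strongly_Wilf_sym[OF \<open>u \<sim>ss v\<close>] unfolding super_strongly_Wilf_def by blast
  show "\<forall>m. \<forall>E \<subseteq> slots (length u) m. height (overlay u E m) = height (overlay v E m)"
  proof (intro allI impI antisym)
    fix m E assume E: "E \<subseteq> slots (length u) m"
    show "height (overlay v E m) \<le> height (overlay u E m)"
      by (rule overlay_height_le[OF f len E])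
    show "height (overlay u E m) \<le> height (overlay v E m)"
      by (rule overlay_height_le[OF g len[symmetric]]) (use E len in simp)
  qed
next
  assume H: "\<forall>m. \<forall>E \<subseteq> slots (length u) m. height (overlay u E m) = height (overlay v E m)"
  define key where "key x w = (length w, height w, Em x w)" for x w
  have fin: "finite {w \<in> words. key x w = k}" for x k
  proof (rule finite_subset)
    show "{w \<in> words. key x w = k} \<subseteq> {w. length w = fst k \<and> height w = fst (snd k)}"
      by (auto simp: key_def)
  qed (rule finite_lists_of_weight)
  have card: "card {w \<in> words. key u w = k} = card {w \<in> words. key v w = k}" for k
  proof -
    obtain m h S where k: "k = (m, h, S)" by (cases k)
    define X where "X = {w \<in> words. length w = m \<and> height w = h}"
    have X: "finite X" unfolding X_def
      by (rule finite_subset[OF _ finite_lists_of_weight[of m h]]) auto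
    have dom: "{w \<in> X. E \<subseteq> Em x w} =
        {w. length w = m \<and> height w = h \<and> (\<forall>k<m. overlay x E m ! k \<le> w ! k)}"
      if "E \<subseteq> slots (length x) m" for x E
    proof -
      have "w \<in> words" if "length w = m" "\<forall>k<m. overlay x E m ! k \<le> w ! k" for w
        using that overlay_nth_ge_1[of _ m x E]
        by (force simp: words_def in_set_conv_nth)
      then show ?thesis using subset_Em_iff[OF that] by (auto simp: X_def)
    qed
    have "card {w \<in> X. E \<subseteq> Em u w} = card {w \<in> X. E \<subseteq> Em v w}" for E
    proof (cases "E \<subseteq> slots (length u) m")
      case True
      then have "height (overlay u E m) = height (overlay v E m)" using H by blast
      then show ?thesis
        using dom[of E u] dom[of E v] True len
          card_dominating_lists_le[of "overlay u E m" m "overlay v E m" h]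
          card_dominating_lists_le[of "overlay v E m" m "overlay u E m" h]
        by simp
    next
      case False
      then have "{w \<in> X. E \<subseteq> Em x w} = {}" if "length x = length u" for x
        using Em_subset_slots[of _ m x] that unfolding X_def by fastforce
      then show ?thesis using len by presburger
    qed
    moreover have "Em x w \<subseteq> slots (length u) m" if "w \<in> X" "length x = length u" for x w
      using that Em_subset_slots[of w m x] by (simp add: X_def)
    ultimately have "card {w \<in> X. Em u w = S} = card {w \<in> X. Em v w = S}"
      using len by (intro card_fibres_eq_of_card_supersets_eq[OF X finite_slots]) auto
    moreover have "{w \<in> words. key x w = k} = {w \<in> X. Em x w = S}" for x
      by (auto simp: key_def X_def k)
    ultimately show ?thesis by simp
  qed
  obtain f where f: "bij_betw f words words" "\<forall>w \<in> words. key v (f w) = key u w"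
    using exists_bij_betw_of_card_fibres[of words "key u" "key v"] fin card by blast
  then show "u \<sim>ss v"
    unfolding super_strongly_Wilf_def weight_preserving_def key_def by (intro exI[of _ f]) auto
qed

text \<open>
  Count the pairs of a position and a threshold reached there. Every position reaches the
  threshold 1, which gives the summand \<open>m\<close>; a threshold \<open>i \<ge> 2\<close> is reached only through a copy
  of \<open>u\<close>.
\<close>
lemma height_overlay:
  assumes E: "E \<subseteq> slots (length u) m" and N: "\<forall>x \<in> set u. x \<le> N"
  shows "height (overlay u E m) = m + (\<Sum>i\<in>{2..N}. card (E + level u i))"
proof -
  let ?x = "\<lambda>k. overlay u E m ! k"
  have nth: "?x k = 1 + (\<Sum>i\<in>{2..N}. of_bool (i \<le> ?x k))" if k: "k < m" for k
  proof -
    have "?x k \<le> max 1 N"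
      using N k by (auto simp: overlay_nth_le_iff intro: max.coboundedI2)
    then have "{i \<in> {2..N}. i \<le> ?x k} = {2..?x k}" by auto
    then show ?thesis using overlay_nth_ge_1[OF k, of u E] by (simp add: sum.If_cases of_bool_def Int_def)
  qed
  have lev: "(\<Sum>k<m. of_bool (i \<le> ?x k)) = card (E + level u i)" if i: "i \<in> {2..N}" for i
  proof -
    have ge: "i \<le> ?x k \<longleftrightarrow> (\<exists>j\<in>E. \<exists>d<length u. j + d = Suc k \<and> i \<le> u ! d)" if "k < m" for k
    proof -
      have le_iff: "i \<le> c \<longleftrightarrow> \<not> c \<le> i - 1" for c using i by auto
      have "1 \<le> i - 1" using i by auto
      then show ?thesis unfolding le_iff overlay_nth_le_iff[OF that] by blast
    qed
    have "E + level u i = Suc ` {k. k < m \<and> i \<le> ?x k}"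
    proof
      show "E + level u i \<subseteq> Suc ` {k. k < m \<and> i \<le> ?x k}"
      proof
        fix p assume "p \<in> E + level u i"
        then obtain j d where jd: "j \<in> E" "d < length u" "i \<le> u ! d" "p = j + d"
          by (auto simp: set_plus_def level_def)
        then have "p - 1 < m" "p = Suc (p - 1)" using E by auto
        then show "p \<in> Suc ` {k. k < m \<and> i \<le> ?x k}" using ge jd by blast
      qed
      show "Suc ` {k. k < m \<and> i \<le> ?x k} \<subseteq> E + level u i"
      proof
        fix p assume "p \<in> Suc ` {k. k < m \<and> i \<le> ?x k}"
        then obtain j d where "j \<in> E" "d < length u" "j + d = p" "i \<le> u ! d" using ge by blast
        then show "p \<in> E + level u i" by (auto simp: level_def)
      qed
    qed
    then have "card (E + level u i) = card {k. k < m \<and> i \<le> ?x k}"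
      by (simp add: card_image)
    then show ?thesis by (simp add: sum.If_cases of_bool_def Int_def)
  qed
  have "height (overlay u E m) = (\<Sum>k<m. ?x k)"
    by (simp add: sum_list_sum_nth atLeast0LessThan)
  also have "\<dots> = (\<Sum>k<m. 1 + (\<Sum>i\<in>{2..N}. of_bool (i \<le> ?x k)))"
    using nth by (intro sum.cong) auto
  also have "\<dots> = m + (\<Sum>i\<in>{2..N}. \<Sum>k<m. of_bool (i \<le> ?x k))"
    unfolding sum.distrib sum.swap[of _ "{..<m}" "{2..N}"] by simp
  finally show ?thesis using lev by simp
qed

lemma super_strongly_Wilf_iff_sumsets:
  assumes len: "length u = length v" and N: "\<forall>x \<in> set u \<union> set v. x \<le> N"
  shows "u \<sim>ss v \<longleftrightarrow> (\<forall>E. finite E \<and> 0 \<notin> E \<longrightarrow>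
    (\<Sum>i\<in>{2..N}. card (E + level u i)) = (\<Sum>i\<in>{2..N}. card (E + level v i)))"
    (is "_ \<longleftrightarrow> (\<forall>E. _ \<longrightarrow> ?eq E)")
proof -
  have iff: "height (overlay u E m) = height (overlay v E m) \<longleftrightarrow> ?eq E"
    if "E \<subseteq> slots (length u) m" for E m
    using height_overlay[of E u m N] height_overlay[of E v m N] that len N by simp
  have slots: "finite E \<and> 0 \<notin> E \<longleftrightarrow> (\<exists>m. E \<subseteq> slots (length u) m)" for E
  proof
    assume E: "finite E \<and> 0 \<notin> E"
    have "E \<subseteq> slots (length u) (Max E + length u)"
    proof
      fix j assume "j \<in> E"
      moreover from this have "j \<le> Max E" using E by simp
      ultimately show "j \<in> slots (length u) (Max E + length u)"
        using E \<open>j \<in> E\<close> by (cases "j = 0") (auto intro: le_trans[OF diff_le_self])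
    qed
    then show "\<exists>m. E \<subseteq> slots (length u) m" by blast
  next
    assume "\<exists>m. E \<subseteq> slots (length u) m"
    then obtain m where "E \<subseteq> slots (length u) m" by blast
    then show "finite E \<and> 0 \<notin> E" using finite_subset[OF _ finite_slots] by auto
  qed
  then show ?thesis
    unfolding super_strongly_Wilf_iff_overlay[OF len] slots using iff by auto
qed

section \<open>Translates and sizes of sumsets\<close>

text \<open>
  Shifting both sides makes the relation symmetric although the naturals have no negative shifts.
\<close>
definition translates :: "nat set \<Rightarrow> nat set \<Rightarrow> bool" where
  "translates A B \<longleftrightarrow> (\<exists>a b. (+) a ` A = (+) b ` B)"

lemma card_sumset_translates:
  assumes "translates A B"
  shows "card (E + A) = card (E + B)"
proof -
  have shift: "card (E + (+) c ` A) = card (E + A)" for c A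
  proof -
    have "E + (+) c ` A = (+) c ` (E + A)"
      by (auto simp: set_plus_def image_iff add.left_commute) blast+
    then show ?thesis by (simp add: card_image)
  qed
  obtain a b where "(+) a ` A = (+) b ` B" using assms by (auto simp: translates_def)
  then show ?thesis using shift[of a A] shift[of b B] by simp
qed

text \<open>
  If \<open>x = e + a\<close> is lost when \<open>D\<close> is removed, then \<open>e \<in> D\<close>. The margin \<open>n\<close> on both sides of \<open>D\<close>
  exceeds the differences of elements of \<open>A\<close>, so every \<open>x - a'\<close> is still in the interval and must
  have been removed as well.
\<close>
lemma sumset_diff:
  fixes A D :: "nat set"
  assumes A: "A \<subseteq> {..<n}" "A \<noteq> {}" and D: "D \<subseteq> {n..M}"
  shows "({1..M + n} + A) - (({1..M + n} - D) + A) = {x. \<forall>a \<in> A. a \<le> x \<and> x - a \<in> D}"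
    (is "?L = ?R")
proof
  show "?L \<subseteq> ?R"
  proof
    fix x assume x: "x \<in> ?L"
    then obtain e a where ea: "e \<in> {1..M + n}" "a \<in> A" "x = e + a" by (auto simp: set_plus_def)
    with x have e: "e \<in> D" by (auto simp: set_plus_def)
    have "a' \<le> x \<and> x - a' \<in> D" if a': "a' \<in> A" for a'
    proof -
      have lt: "a < n" "a' < n" using A ea a' by auto
      have le: "n \<le> e" "e \<le> M" using e D by auto
      have "1 \<le> x - a'" "x - a' \<le> M + n" "x = (x - a') + a'" using lt le ea(3) by simp_all
      then have in_range: "x - a' \<in> {1..M + n}" "x = (x - a') + a'" by simp_all
      have "x - a' \<in> D"
      proof (rule ccontr)
        assume "x - a' \<notin> D"
        with in_range a' have "x \<in> ({1..M + n} - D) + A" by (auto simp: set_plus_def)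
        then show False using x by blast
      qed
      then show ?thesis using in_range by linarith
    qed
    then show "x \<in> ?R" by blast
  qed
  show "?R \<subseteq> ?L"
  proof
    fix x assume x: "x \<in> ?R"
    obtain a where a: "a \<in> A" using A by blast
    then have "x = (x - a) + a" "x - a \<in> D" using x by auto
    moreover from this have "x - a \<in> {1..M + n}" using D a A by force
    ultimately have "x \<in> {1..M + n} + A" using a by (metis set_plus_intro)
    moreover have "x \<notin> ({1..M + n} - D) + A" using x by (auto simp: set_plus_def)
    ultimately show "x \<in> ?L" by blast
  qed
qed

text \<open>
  The induction is on the size of \<open>A k\<close>. The index set \<open>J\<close> discards the smaller members, which
  are already known to be translates and cancel from every instance of the hypothesis; \<open>cnt S\<close> is the
  number of translates of the reflection of \<open>S\<close> inside \<open>D\<close>.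
\<close>
lemma translates_of_sum_card_sumset_eq:
  fixes A B :: "'i \<Rightarrow> nat set"
  assumes I: "finite I" and inj: "inj_on (\<lambda>i. card (A i)) I"
    and card: "\<And>i. i \<in> I \<Longrightarrow> card (B i) = card (A i)"
    and ne: "\<And>i. i \<in> I \<Longrightarrow> A i \<noteq> {} \<and> B i \<noteq> {}"
    and sub: "\<And>i. i \<in> I \<Longrightarrow> A i \<subseteq> {..<n} \<and> B i \<subseteq> {..<n}"
    and eq: "\<And>E. finite E \<Longrightarrow> 0 \<notin> E \<Longrightarrow> (\<Sum>i\<in>I. card (E + A i)) = (\<Sum>i\<in>I. card (E + B i))"
    and k: "k \<in> I"
  shows "translates (A k) (B k)"
  using k
proof (induction "card (A k)" arbitrary: k rule: less_induct)
  case less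
  define D where "D = (\<lambda>a. 2 * n - a) ` A k"
  define J where "J = {i \<in> I. card (A k) \<le> card (A i)}"
  define cnt where "cnt S = card {x. \<forall>a \<in> S. a \<le> x \<and> x - a \<in> D}" for S
  have finA: "finite (A i)" "finite (B i)" if "i \<in> I" for i
    using sub[OF that] by (auto intro: finite_subset)
  have Ak: "a < n" if "a \<in> A k" for a using sub[OF less.prems] that by auto
  have D: "D \<subseteq> {n..2 * n}" using Ak by (fastforce simp: D_def)
  have cD: "card D = card (A k)" unfolding D_def
    by (rule card_image, rule inj_onI) (use Ak in fastforce)
  have finD: "finite D" using D by (rule finite_subset) simp
  have eqJ: "(\<Sum>i\<in>J. card (E + A i)) = (\<Sum>i\<in>J. card (E + B i))" if "finite E" "0 \<notin> E" for E
  proof -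
    have small: "(\<Sum>i\<in>I - J. card (E + A i)) = (\<Sum>i\<in>I - J. card (E + B i))"
      by (intro sum.cong refl card_sumset_translates less.hyps) (auto simp: J_def)
    have "J \<subseteq> I" by (auto simp: J_def)
    then show ?thesis
      using eq[OF that] small sum.subset_diff[OF _ I, of J] by (metis add_left_cancel)
  qed
  have cnt: "card (({1..2 * n + n} - D) + S) + cnt S = card ({1..2 * n + n} + S)"
    and fin_cnt: "finite {x. \<forall>a \<in> S. a \<le> x \<and> x - a \<in> D}"
    if S: "S \<subseteq> {..<n}" "S \<noteq> {}" for S
  proof -
    have fin: "finite ({1..2 * n + n} + S)"
      using S by (intro finite_set_plus) (auto intro: finite_subset)
    have ss: "({1..2 * n + n} - D) + S \<subseteq> {1..2 * n + n} + S"
      by (intro set_plus_mono2) auto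
    show "card (({1..2 * n + n} - D) + S) + cnt S = card ({1..2 * n + n} + S)"
      using card_Diff_subset[OF finite_subset[OF ss fin] ss] card_mono[OF fin ss]
      unfolding cnt_def sumset_diff[OF S D, symmetric] by simp
    show "finite {x. \<forall>a \<in> S. a \<le> x \<and> x - a \<in> D}"
      unfolding sumset_diff[OF S D, symmetric] using fin by blast
  qed
  have sumcnt: "(\<Sum>i\<in>J. cnt (A i)) = (\<Sum>i\<in>J. cnt (B i))"
  proof -
    let ?E = "{1..2 * n + n}"
    have "(\<Sum>i\<in>J. card ((?E - D) + S i)) + (\<Sum>i\<in>J. cnt (S i)) = (\<Sum>i\<in>J. card (?E + S i))"
      if "\<And>i. i \<in> I \<Longrightarrow> S i \<subseteq> {..<n} \<and> S i \<noteq> {}" for S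
      unfolding sum.distrib[symmetric] using that cnt by (intro sum.cong refl) (auto simp: J_def)
    from this[of A] this[of B] show ?thesis
      using eqJ[of ?E] eqJ[of "?E - D"] sub ne by simp
  qed
  have kJ: "k \<in> J" "finite J" using less.prems I by (auto simp: J_def)
  \<comment> \<open>\<open>D\<close> is the reflection of \<open>A k\<close> with centre \<open>2 * n\<close>, so \<open>A k\<close> itself is counted. Some
    \<open>B i\<close> with \<open>i \<in> J\<close> is then counted too, and it can only be \<open>B k\<close>, since it must fit into \<open>D\<close>.\<close>
  have "2 * n \<in> {x. \<forall>a \<in> A k. a \<le> x \<and> x - a \<in> D}" using Ak by (force simp: D_def)
  then have "0 < cnt (A k)"
    using fin_cnt[of "A k"] sub[OF less.prems] ne[OF less.prems] by (auto simp: cnt_def card_gt_0_iff)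
  then have "0 < (\<Sum>i\<in>J. cnt (A i))" using kJ by (metis gr0I sum_eq_0_iff less_numeral_extra(3))
  then obtain i where i: "i \<in> J" "cnt (B i) \<noteq> 0"
    unfolding sumcnt by (metis sum.neutral less_numeral_extra(3))
  then obtain x where x: "\<And>b. b \<in> B i \<Longrightarrow> b \<le> x \<and> x - b \<in> D"
    unfolding cnt_def by (metis (mono_tags, lifting) Collect_empty_eq card.empty)
  have iI: "i \<in> I" using i by (simp add: J_def)
  have sD: "(\<lambda>b. x - b) ` B i \<subseteq> D" using x by auto
  have cB: "card ((\<lambda>b. x - b) ` B i) = card (A i)"
    unfolding card[OF iI, symmetric]
    by (rule card_image, rule inj_onI) (use x in \<open>metis diff_diff_cancel\<close>)
  have "card (A i) \<le> card (A k)" using card_mono[OF finD sD] cB cD by simp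
  then have "card (A i) = card (A k)" using i by (simp add: J_def)
  then have ik: "i = k" using inj iI less.prems by (auto dest: inj_onD)
  have sD': "(\<lambda>b. x - b) ` B k = (\<lambda>a. 2 * n - a) ` A k"
    using card_subset_eq[OF finD sD] cB cD ik by (simp add: D_def)
  have "(+) x ` A k = (+) (2 * n) ` B k"
  proof (intro equalityI subsetI)
    fix y assume "y \<in> (+) x ` A k"
    then obtain a where a: "a \<in> A k" "y = x + a" by blast
    then obtain b where b: "b \<in> B k" "x - b = 2 * n - a" using sD' by (metis imageE imageI)
    then have "y = 2 * n + b" using x[of b] ik Ak[OF a(1)] a by simp
    then show "y \<in> (+) (2 * n) ` B k" using b by blast
  next
    fix y assume "y \<in> (+) (2 * n) ` B k"
    then obtain b where b: "b \<in> B k" "y = 2 * n + b" by blast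
    then obtain a where a: "a \<in> A k" "x - b = 2 * n - a" using sD' by (metis imageE imageI)
    then have "y = x + a" using x[of b] ik Ak[OF a(1)] b by simp
    then show "y \<in> (+) x ` A k" using a by blast
  qed
  then show ?case unfolding translates_def by blast
qed

section \<open>Difference vectors of finite sets\<close>

text \<open>
  \<open>Delta i s\<close> is \<open>gaps\<close> of the increasing enumeration of \<open>Sigma_set i s\<close>.
\<close>
definition gaps :: "nat list \<Rightarrow> nat list" where
  "gaps xs = map (\<lambda>k. xs ! Suc k - xs ! k) [0..<length xs - 1]"

lemma sorted_list_of_set_translate:
  fixes A :: "nat set"
  assumes "finite A"
  shows "sorted_list_of_set ((+) c ` A) = map ((+) c) (sorted_list_of_set A)"
  using assms
  by (intro sorted_distinct_set_unique) (auto simp: distinct_map sorted_map intro: sorted_wrt_mono_rel[OF _ sorted_sorted_list_of_set])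

lemma gaps_map_plus: "gaps (map ((+) c) xs) = gaps xs"
  by (auto simp: gaps_def)

text \<open>
  Equal gaps mean that the two lists differ by a constant, expressed by adding the other list's first
  entry on each side.
\<close>
lemma gaps_eq_imp_nth:
  assumes xs: "sorted xs" and ys: "sorted ys" and len: "length xs = length ys" and gaps: "gaps xs = gaps ys"
    and k: "k < length xs"
  shows "ys ! 0 + xs ! k = xs ! 0 + ys ! k"
  using k
proof (induction k)
  case (Suc k)
  have "gaps xs ! k = gaps ys ! k" using gaps by simp
  then have "xs ! Suc k - xs ! k = ys ! Suc k - ys ! k" using Suc.prems len by (simp add: gaps_def)
  moreover have "xs ! k \<le> xs ! Suc k" "ys ! k \<le> ys ! Suc k"
    using Suc.prems xs ys len by (auto simp: sorted_nth_mono)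
  ultimately show ?case using Suc by linarith
qed simp

lemma gaps_eq_iff_translates:
  assumes fin: "finite A" "finite B" and ne: "A \<noteq> {}" "B \<noteq> {}"
  shows "gaps (sorted_list_of_set A) = gaps (sorted_list_of_set B) \<longleftrightarrow> translates A B"
proof
  let ?xs = "sorted_list_of_set A" and ?ys = "sorted_list_of_set B"
  assume g: "gaps ?xs = gaps ?ys"
  have "length ?xs - 1 = length ?ys - 1" using arg_cong[OF g, of length] by (simp add: gaps_def)
  moreover have "0 < length ?xs" "0 < length ?ys" using fin ne by (auto simp: card_gt_0_iff)
  ultimately have len: "length ?xs = length ?ys" by linarith
  have "map ((+) (?ys ! 0)) ?xs = map ((+) (?xs ! 0)) ?ys"
    using len gaps_eq_imp_nth[OF _ _ len g] by (intro nth_equalityI) auto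
  then have "set (map ((+) (?ys ! 0)) ?xs) = set (map ((+) (?xs ! 0)) ?ys)" by (simp only:)
  then show "translates A B" using fin unfolding translates_def by auto
next
  assume "translates A B"
  then obtain a b where "(+) a ` A = (+) b ` B" by (auto simp: translates_def)
  then show "gaps (sorted_list_of_set A) = gaps (sorted_list_of_set B)"
    using sorted_list_of_set_translate[OF fin(1), of a] sorted_list_of_set_translate[OF fin(2), of b]
      gaps_map_plus by metis
qed

section \<open>Level sets of permutations\<close>

lemma position_nth:
  assumes "distinct u" "d < length u"
  shows "position u (u ! d) = Suc d"
  unfolding position_def
proof (rule the_equality)
  fix p assume "p \<in> {1..length u} \<and> u ! (p - 1) = u ! d"
  then have "p - 1 = d" using assms nth_eq_iff_index_eq[of u "p - 1" d] by auto
  then show "p = Suc d" using \<open>p \<in> {1..length u} \<and> _\<close> by auto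
qed (use assms in auto)

lemma Sigma_set_perm_inverse:
  assumes u: "u \<in> permutations_of_set {1..n}" and i: "1 \<le> i"
  shows "Sigma_set i (perm_inverse u) = Suc ` level u i"
proof -
  have du: "distinct u" and su: "set u = {1..n}" and lu: "length u = n"
    using u length_finite_permutations_of_set[OF u] by (auto dest: permutations_of_setD)
  have "Sigma_set i (perm_inverse u) = position u ` {i..n}"
  proof -
    have "Sigma_set i (perm_inverse u) = (\<lambda>k. perm_inverse u ! (k - 1)) ` {i..n}"
      using lu by (auto simp: Sigma_set_def perm_inverse_def)
    also have "\<dots> = position u ` {i..n}"
      using i lu by (intro image_cong) (auto simp: perm_inverse_def nth_upt simp del: upt_Suc)
    finally show ?thesis .
  qed
  also have "{i..n} = (\<lambda>d. u ! d) ` level u i"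
  proof (intro equalityI subsetI)
    fix x assume x: "x \<in> {i..n}"
    then have "x \<in> set u" using su i by auto
    then show "x \<in> (\<lambda>d. u ! d) ` level u i" using x by (auto simp: in_set_conv_nth level_def)
  next
    fix x assume "x \<in> (\<lambda>d. u ! d) ` level u i"
    then obtain d where "d < length u" "i \<le> u ! d" "x = u ! d" by (auto simp: level_def)
    then show "x \<in> {i..n}" using nth_mem[of d u] su by auto
  qed
  also have "position u ` (\<lambda>d. u ! d) ` level u i = Suc ` level u i"
    unfolding image_image using du by (intro image_cong) (auto simp: level_def position_nth)
  finally show ?thesis .
qed

lemma card_level_permutation:
  assumes u: "u \<in> permutations_of_set {1..n}" and i: "1 \<le> i"
  shows "card (level u i) = Suc n - i"
proof -
  have du: "distinct u" and su: "set u = {1..n}"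
    using u by (auto dest: permutations_of_setD)
  have "(\<lambda>d. u ! d) ` level u i = {x \<in> set u. i \<le> x}"
    by (auto simp: level_def in_set_conv_nth)
  also have "\<dots> = {i..n}" using su i by auto
  finally have "card ((\<lambda>d. u ! d) ` level u i) = Suc n - i" by simp
  moreover have "inj_on (\<lambda>d. u ! d) (level u i)"
    using du by (auto simp: inj_on_def level_def nth_eq_iff_index_eq)
  ultimately show ?thesis by (simp add: card_image)
qed

theorem theorem3:
  fixes n :: nat and u v s t :: "nat list"
  assumes "u \<in> permutations_of_set {1..n}" and "v \<in> permutations_of_set {1..n}"
    and "s = perm_inverse u" and "t = perm_inverse v"
  shows "u \<sim>ss v \<longleftrightarrow> (\<forall>i \<in> {2..n - 1}. Delta i s = Delta i t)"
proof -
  have len: "length u = n" "length v = n"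
    using assms(1,2) length_finite_permutations_of_set by fastforce+
  have N: "\<forall>x \<in> set u \<union> set v. x \<le> n"
    using assms(1,2) by (auto dest: permutations_of_setD)
  have ne: "level u i \<noteq> {}" "level v i \<noteq> {}" if "i \<in> {2..n}" for i
    using that card_level_permutation[OF assms(1), of i] card_level_permutation[OF assms(2), of i]
    by force+
  have Delta: "Delta i s = Delta i t \<longleftrightarrow> translates (level u i) (level v i)" if i: "i \<in> {2..n}" for i
  proof -
    have "Delta i (perm_inverse w) = gaps (sorted_list_of_set (level w i))"
      if "w \<in> permutations_of_set {1..n}" for w
      using sorted_list_of_set_translate[of "level w i" 1] gaps_map_plus[of 1]
        Sigma_set_perm_inverse[OF that, of i] i
      by (simp add: Delta_def Let_def gaps_def)
    then show ?thesis using assms gaps_eq_iff_translates[OF _ _ ne[OF i]] by simp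
  qed
  have top: "translates (level u n) (level v n)" if "2 \<le> n"
  proof -
    have "card (level u n) = 1" "card (level v n) = 1"
      using that card_level_permutation assms(1,2) by auto
    then obtain a b where "level u n = {a}" "level v n = {b}" by (metis card_1_singletonE)
    then have "(+) b ` level u n = (+) a ` level v n" by simp
    then show ?thesis unfolding translates_def by blast
  qed
  have "u \<sim>ss v \<longleftrightarrow> (\<forall>i \<in> {2..n}. translates (level u i) (level v i))"
  proof
    assume W: "u \<sim>ss v"
    have "translates (level u i) (level v i)" if "i \<in> {2..n}" for i
    proof (rule translates_of_sum_card_sumset_eq[where I = "{2..n}" and n = n])
      show "inj_on (\<lambda>i. card (level u i)) {2..n}"
        using card_level_permutation[OF assms(1)] by (auto simp: inj_on_def)
      show "card (level v i) = card (level u i)" if "i \<in> {2..n}" for i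
        using that card_level_permutation[OF assms(1), of i] card_level_permutation[OF assms(2), of i]
        by simp
      show "level u i \<subseteq> {..<n} \<and> level v i \<subseteq> {..<n}" for i
        using len by (auto simp: level_def)
    qed (use that ne W super_strongly_Wilf_iff_sumsets[of u v n] len N in auto)
    then show "\<forall>i \<in> {2..n}. translates (level u i) (level v i)" by blast
  next
    assume "\<forall>i \<in> {2..n}. translates (level u i) (level v i)"
    then have "(\<Sum>i\<in>{2..n}. card (E + level u i)) = (\<Sum>i\<in>{2..n}. card (E + level v i))" for E
      by (intro sum.cong refl card_sumset_translates) blast
    then show "u \<sim>ss v" using super_strongly_Wilf_iff_sumsets[of u v n] len N by auto
  qed
  also have "\<dots> \<longleftrightarrow> (\<forall>i \<in> {2..n - 1}. translates (level u i) (level v i))"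
  proof
    assume H: "\<forall>i \<in> {2..n - 1}. translates (level u i) (level v i)"
    show "\<forall>i \<in> {2..n}. translates (level u i) (level v i)"
    proof
      fix i assume "i \<in> {2..n}"
      then show "translates (level u i) (level v i)" using H top by (cases "i = n") auto
    qed
  qed auto
  also have "\<dots> \<longleftrightarrow> (\<forall>i \<in> {2..n - 1}. Delta i s = Delta i t)"
    by (intro ball_cong refl Delta[symmetric]) auto
  finally show ?thesis .
qed

end
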